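(* Let $\mathfrak{g}$ be a simple Lie algebra over a field of characteristic $2$. If $\mathfrak{g}$ is taut, then every CPA-structure on $\mathfrak{g}$ is either trivial (i.e. $x\cdot y=0$ for all $x,y\in\mathfrak{g}$) or adjoint (i.e. $x\cdot y=[x,y]$ for all $x,y\in\mathfrak{g}$).
   Context: All Lie algebras are finite-dimensional. A simple Lie algebra is a non-abelian Lie algebra with no nontrivial proper ideals. $\mathrm{Der}(\mathfrak{g})$ is the Lie algebra of derivations of $\mathfrak{g}$ and $\mathrm{Inn}(\mathfrak{g})$ the ideal of inner derivations. $\mathfrak{g}$ is called taut if every Lie algebra homomorphism $\varphi\colon\mathfrak{g}\to\mathrm{Der}(\mathfrak{g})$ satisfies $\varphi(\mathfrak{g})\subseteq\mathrm{Inn}(\mathfrak{g})$. A CPA-structure on a Lie algebra $\mathfrak{g}$ over a field $K$ is a $K$-bilinear product $x\cdot y$ on $\mathfrak{g}$ satisfying, for all $x,y,z\in\mathfrak{g}$: $x\cdot y=y\cdot x$; $[x,y]\cdot z=x\cdot(y\cdot z)-y\cdot(x\cdot z)$; $x\cdot[y,z]=[x\cdot y,z]+[y,x\cdot z]$. *)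

theory Defs
  imports
    Complex_Main
    "HOL-Library.Function_Algebras"
begin

definition bilinear_product ::
    "('k::field \<Rightarrow> 'v::ab_group_add \<Rightarrow> 'v) \<Rightarrow> ('v \<Rightarrow> 'v \<Rightarrow> 'v) \<Rightarrow> bool" where
  "bilinear_product scale f \<longleftrightarrow>
     (\<forall>x. Vector_Spaces.linear scale scale (\<lambda>y. f x y)) \<and>
     (\<forall>y. Vector_Spaces.linear scale scale (\<lambda>x. f x y))"

text \<open>
  The underlying vector space of a Lie algebra is the whole type \<^typ>\<open>'v\<close>, with scalar
  multiplication \<open>scale\<close>. The bracket is required to be alternating, which in characteristic 2
  is stronger than antisymmetry.
\<close>

locale lie_algebra = vector_space scale
  for scale :: "'k::field \<Rightarrow> 'v::ab_group_add \<Rightarrow> 'v" +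
  fixes bracket :: "'v \<Rightarrow> 'v \<Rightarrow> 'v"
  assumes bracket_bilinear: "bilinear_product scale bracket"
    and bracket_alternating: "bracket x x = 0"
    and jacobi:
      "bracket x (bracket y z) + bracket y (bracket z x) + bracket z (bracket x y) = 0"

locale fin_dim_lie_algebra = lie_algebra scale bracket
  for scale :: "'k::field \<Rightarrow> 'v::ab_group_add \<Rightarrow> 'v" and bracket :: "'v \<Rightarrow> 'v \<Rightarrow> 'v" +
  assumes finite_dimensional: "\<exists>B. finite_dimensional_vector_space scale B"

definition lie_ideal ::
    "('k::field \<Rightarrow> 'v::ab_group_add \<Rightarrow> 'v) \<Rightarrow> ('v \<Rightarrow> 'v \<Rightarrow> 'v) \<Rightarrow> 'v set \<Rightarrow> bool" where
  "lie_ideal scale bracket I \<longleftrightarrow>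
     module.subspace scale I \<and> (\<forall>x. \<forall>y\<in>I. bracket x y \<in> I)"

locale simple_lie_algebra = fin_dim_lie_algebra scale bracket
  for scale :: "'k::field \<Rightarrow> 'v::ab_group_add \<Rightarrow> 'v" and bracket :: "'v \<Rightarrow> 'v \<Rightarrow> 'v" +
  assumes non_abelian: "\<exists>x y. bracket x y \<noteq> 0"
    and no_proper_ideals: "lie_ideal scale bracket I \<Longrightarrow> I = {0} \<or> I = UNIV"

definition Der ::
    "('k::field \<Rightarrow> 'v::ab_group_add \<Rightarrow> 'v) \<Rightarrow> ('v \<Rightarrow> 'v \<Rightarrow> 'v) \<Rightarrow> ('v \<Rightarrow> 'v) set" where
  "Der scale bracket =
     {D. Vector_Spaces.linear scale scale D \<and>
         (\<forall>x y. D (bracket x y) = bracket (D x) y + bracket x (D y))}"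

definition Inn :: "('v \<Rightarrow> 'v \<Rightarrow> 'v) \<Rightarrow> ('v \<Rightarrow> 'v) set" where
  "Inn bracket = range (\<lambda>x. (\<lambda>y. bracket x y))"

definition fun_scale :: "('k \<Rightarrow> 'v \<Rightarrow> 'v) \<Rightarrow> 'k \<Rightarrow> ('v \<Rightarrow> 'v) \<Rightarrow> ('v \<Rightarrow> 'v)" where
  "fun_scale scale c f = (\<lambda>x. scale c (f x))"

definition commutator :: "('v \<Rightarrow> 'v) \<Rightarrow> ('v \<Rightarrow> 'v) \<Rightarrow> ('v \<Rightarrow> 'v::ab_group_add)" where
  "commutator f g = (\<lambda>x. f (g x) - g (f x))"

text \<open>
  \<^term>\<open>Der scale bracket\<close> is a set of functions; its Lie algebra structure is given by pointwise
  addition, \<^const>\<open>fun_scale\<close> and \<^const>\<open>commutator\<close>. A homomorphism into it is a function with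
  values in this set that is linear and compatible with the brackets.
\<close>

definition lie_hom_to_Der ::
    "('k::field \<Rightarrow> 'v::ab_group_add \<Rightarrow> 'v) \<Rightarrow> ('v \<Rightarrow> 'v \<Rightarrow> 'v) \<Rightarrow> ('v \<Rightarrow> 'v \<Rightarrow> 'v) \<Rightarrow> bool" where
  "lie_hom_to_Der scale bracket \<phi> \<longleftrightarrow>
     range \<phi> \<subseteq> Der scale bracket \<and>
     Vector_Spaces.linear scale (fun_scale scale) \<phi> \<and>
     (\<forall>x y. \<phi> (bracket x y) = commutator (\<phi> x) (\<phi> y))"

definition taut ::
    "('k::field \<Rightarrow> 'v::ab_group_add \<Rightarrow> 'v) \<Rightarrow> ('v \<Rightarrow> 'v \<Rightarrow> 'v) \<Rightarrow> bool" where
  "taut scale bracket \<longleftrightarrow>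
     (\<forall>\<phi>. lie_hom_to_Der scale bracket \<phi> \<longrightarrow> range \<phi> \<subseteq> Inn bracket)"

definition cpa_structure ::
    "('k::field \<Rightarrow> 'v::ab_group_add \<Rightarrow> 'v) \<Rightarrow> ('v \<Rightarrow> 'v \<Rightarrow> 'v) \<Rightarrow> ('v \<Rightarrow> 'v \<Rightarrow> 'v) \<Rightarrow> bool" where
  "cpa_structure scale bracket p \<longleftrightarrow>
     bilinear_product scale p \<and>
     (\<forall>x y. p x y = p y x) \<and>
     (\<forall>x y z. p (bracket x y) z = p x (p y z) - p y (p x z)) \<and>
     (\<forall>x y z. p x (bracket y z) = bracket (p x y) z + bracket y (p x z))"

lemma (in vector_space) vector_space_fun_scale: "vector_space (fun_scale scale)"
  by unfold_locales (auto simp: fun_scale_def fun_eq_iff algebra_simps)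

context lie_algebra
begin

lemma linear_iff_add_scale:
  "Vector_Spaces.linear scale scale f \<longleftrightarrow>
     (\<forall>x y. f (x + y) = f x + f y) \<and> (\<forall>c x. f (scale c x) = scale c (f x))"
  by (simp add: Vector_Spaces.linear_iff vector_space_axioms)

lemma bracket_add_right: "bracket x (y + z) = bracket x y + bracket x z"
  using bracket_bilinear by (simp add: bilinear_product_def linear_iff_add_scale)

lemma bracket_add_left: "bracket (x + y) z = bracket x z + bracket y z"
  using bracket_bilinear by (simp add: bilinear_product_def linear_iff_add_scale)

lemma bracket_scale_right: "bracket x (scale c y) = scale c (bracket x y)"
  using bracket_bilinear by (simp add: bilinear_product_def linear_iff_add_scale)

lemma bracket_scale_left: "bracket (scale c x) y = scale c (bracket x y)"
  using bracket_bilinear by (simp add: bilinear_product_def linear_iff_add_scale)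

lemma bracket_antisym: "bracket y x = - bracket x y"
proof -
  have "0 = bracket (x + y) (x + y)"
    by (rule bracket_alternating[symmetric])
  also have "\<dots> = bracket x x + bracket y x + (bracket x y + bracket y y)"
    by (simp only: bracket_add_left bracket_add_right)
  also have "\<dots> = bracket x y + bracket y x"
    by (simp add: bracket_alternating add.commute)
  finally show ?thesis
    by (intro minus_unique[symmetric]) simp
qed

lemma bracket_zero_left: "bracket 0 x = 0"
  using bracket_add_left[of 0 0 x] by simp

lemma bracket_zero_right: "bracket x 0 = 0"
  using bracket_add_right[of x 0 0] by simp

lemma bracket_minus_left: "bracket (- x) y = - bracket x y"
  using bracket_add_left[of x "- x" y]
  by (intro minus_unique[symmetric]) (simp add: bracket_zero_left)

lemma bracket_minus_right: "bracket x (- y) = - bracket x y"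
  using bracket_add_right[of x y "- y"]
  by (intro minus_unique[symmetric]) (simp add: bracket_zero_right)

lemma bracket_diff_left: "bracket (x - y) z = bracket x z - bracket y z"
  using bracket_add_left[of x "- y" z] by (simp add: bracket_minus_left)

lemma bracket_diff_right: "bracket x (y - z) = bracket x y - bracket x z"
  using bracket_add_right[of x y "- z"] by (simp add: bracket_minus_right)

lemma Der_iff:
  "D \<in> Der scale bracket \<longleftrightarrow>
     (\<forall>x y. D (x + y) = D x + D y) \<and> (\<forall>c x. D (scale c x) = scale c (D x)) \<and>
     (\<forall>x y. D (bracket x y) = bracket (D x) y + bracket x (D y))"
  unfolding Der_def by (auto simp: linear_iff_add_scale)

lemma subspace_Der: "module.subspace (fun_scale scale) (Der scale bracket)"
proof -
  interpret F: vector_space "fun_scale scale" by (rule vector_space_fun_scale)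
  show ?thesis
    unfolding F.subspace_def
    by (auto simp: Der_iff fun_scale_def bracket_zero_left bracket_zero_right scale_right_distrib
        bracket_add_left bracket_add_right bracket_scale_left bracket_scale_right mult.commute)
qed

lemma commutator_Der:
  assumes "D \<in> Der scale bracket" "E \<in> Der scale bracket"
  shows "commutator D E \<in> Der scale bracket"
proof -
  have D: "D (x + y) = D x + D y" "D (scale c x) = scale c (D x)"
      "D (bracket x y) = bracket (D x) y + bracket x (D y)" for c x y
    using assms(1) by (auto simp: Der_iff)
  have E: "E (x + y) = E x + E y" "E (scale c x) = scale c (E x)"
      "E (bracket x y) = bracket (E x) y + bracket x (E y)" for c x y
    using assms(2) by (auto simp: Der_iff)
  show ?thesis
    unfolding Der_iff commutator_def
    by (simp add: D E bracket_diff_left bracket_diff_right scale_right_diff_distrib)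
qed

lemma Inn_subset_Der: "Inn bracket \<subseteq> Der scale bracket"
proof -
  have leibniz: "bracket a (bracket x y) = bracket (bracket a x) y + bracket x (bracket a y)" for a x y
  proof -
    have "bracket a (bracket x y) = - bracket x (bracket y a) - bracket y (bracket a x)"
    proof -
      have "u = - v - w" if "u + v + w = 0" for u v w :: 'v
        using that by (simp add: eq_diff_eq eq_neg_iff_add_eq_0 add.assoc add.commute[of w v])
      then show ?thesis using jacobi[of a x y] .
    qed
    also have "\<dots> = bracket x (bracket a y) + bracket (bracket a x) y"
      by (simp add: bracket_antisym[of y a] bracket_antisym[of y "bracket a x"] bracket_minus_right)
    finally show ?thesis by (simp add: add.commute)
  qed
  show ?thesis
    by (auto simp: Inn_def Der_iff bracket_add_right bracket_scale_right intro: leibniz)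
qed

end

end

theory Submission
  imports Defs
begin

text \<open>
  Left multiplications of a CPA-structure form a homomorphism into the derivations, so tautness
  and triviality of the center give \<open>p x y = [T x, y]\<close> for an endomorphism \<open>T\<close> of the Lie algebra.
  Its kernel is an ideal, so \<open>T = 0\<close> or \<open>T\<close> is injective. In characteristic 2, commutativity
  says \<open>[T x, y] = [x, T y]\<close>, whence \<open>T [x, y] = [T\<^sup>2 x, y]\<close>. With \<open>R = T - T\<^sup>2\<close>, the Jacobi
  identity makes \<open>f x y z = [R x, [y, z]]\<close> totally symmetric, and comparing the action of \<open>T\<close>
  on the three arguments gives \<open>f (R x) y z = 0\<close>, so \<open>R\<^sup>2 = T\<^sup>2 (1 - T)\<^sup>2 = 0\<close>. If \<open>T\<close> is injective
  then \<open>T\<^sup>2 = 1\<close>, so \<open>T\<close> fixes all brackets and therefore is the identity.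
\<close>

lemma (in vector_space) add_self_CHAR_2:
  assumes "CHAR('a) = 2"
  shows "(x :: 'b) + x = 0"
proof -
  have "(1 + 1 :: 'a) = of_nat CHAR('a)"
    using assms by simp
  then have "(1 + 1 :: 'a) = 0"
    by (simp only: of_nat_CHAR)
  then have "scale (1 + 1) x = 0"
    by simp
  then show ?thesis
    by (simp only: scale_left_distrib scale_one)
qed

context lie_algebra
begin

lemma jacobi_leibniz:
  "bracket a (bracket x y) = bracket (bracket a x) y + bracket x (bracket a y)"
proof -
  have "bracket a \<in> Der scale bracket"
    using Inn_subset_Der by (auto simp: Inn_def)
  then show ?thesis
    by (simp add: Der_iff)
qed

lemma cpa_add:
  assumes "cpa_structure scale bracket p"
  shows "p (x + y) z = p x z + p y z" "p x (y + z) = p x y + p x z"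
  using assms by (simp_all add: cpa_structure_def bilinear_product_def linear_iff_add_scale)

lemma cpa_scale:
  assumes "cpa_structure scale bracket p"
  shows "p (scale c x) y = scale c (p x y)" "p x (scale c y) = scale c (p x y)"
  using assms by (simp_all add: cpa_structure_def bilinear_product_def linear_iff_add_scale)

text \<open>The axiom for \<open>p x (bracket y z)\<close> is the Leibniz rule for
  \<open>p x\<close>; the axiom for \<open>p (bracket x y) z\<close> is compatibility with
  commutators.\<close>

lemma cpa_lie_hom_to_Der:
  assumes "cpa_structure scale bracket p"
  shows "lie_hom_to_Der scale bracket p"
proof -
  have "range p \<subseteq> Der scale bracket"
    using cpa_add(2)[OF assms] cpa_scale(2)[OF assms] assms
    by (auto simp only: Der_iff cpa_structure_def)
  moreover have "Vector_Spaces.linear scale (fun_scale scale) p"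
    using assms
    by (auto simp: Vector_Spaces.linear_iff vector_space_axioms vector_space_fun_scale
        fun_scale_def fun_eq_iff cpa_add cpa_scale)
  moreover have "p (bracket x y) = commutator (p x) (p y)" for x y
    using assms unfolding commutator_def cpa_structure_def by (intro ext) blast
  ultimately show ?thesis
    by (simp add: lie_hom_to_Der_def)
qed

end

context simple_lie_algebra
begin

text \<open>The center is an ideal, and it is proper because the algebra is non-abelian.\<close>

lemma center_trivial:
  assumes "\<And>y. bracket x y = 0"
  shows "x = 0"
proof -
  have "bracket w x = 0" if "\<forall>y. bracket x y = 0" for w x
    using that by (subst bracket_antisym) simp
  then have "lie_ideal scale bracket {x. \<forall>y. bracket x y = 0}"
    by (auto simp: lie_ideal_def subspace_def bracket_zero_left bracket_add_left
        bracket_scale_left)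
  then show ?thesis
    using no_proper_ideals non_abelian assms by fastforce
qed

lemma eqI_bracket: "(\<And>y. bracket x y = bracket x' y) \<Longrightarrow> x = x'"
  using center_trivial[of "x - x'"] by (simp add: bracket_diff_left)

text \<open>By the Leibniz rule the annihilator of all brackets is an ideal. If it were everything,
  every bracket would be central, hence zero.\<close>

lemma annihilator_derived_trivial:
  assumes "\<And>y z. bracket x (bracket y z) = 0"
  shows "x = 0"
proof -
  let ?I = "{x. \<forall>y z. bracket x (bracket y z) = 0}"
  have "bracket (bracket a x) (bracket y z) = 0" if "x \<in> ?I" for a x y z
    using that jacobi_leibniz[of a x "bracket y z"] by (simp add: jacobi_leibniz[of a y z]
      bracket_add_right bracket_zero_right)
  then have "lie_ideal scale bracket ?I"
    by (auto simp: lie_ideal_def subspace_def bracket_zero_left bracket_add_left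
        bracket_scale_left)
  moreover have "?I \<noteq> UNIV"
  proof
    assume "?I = UNIV"
    then have "bracket (bracket y z) x = 0" for x y z
      by (subst bracket_antisym) auto
    then show False
      using center_trivial non_abelian by blast
  qed
  ultimately show ?thesis
    using no_proper_ideals assms by blast
qed

lemma eqI_bracket_bracket:
  "(\<And>y z. bracket x (bracket y z) = bracket x' (bracket y z)) \<Longrightarrow> x = x'"
  using annihilator_derived_trivial[of "x - x'"] by (simp add: bracket_diff_left)

lemma endomorphism_zero_or_inj:
  assumes "\<And>x y. T (x + y) = T x + T y" "\<And>c x. T (scale c x) = scale c (T x)"
    and "\<And>x y. T (bracket x y) = bracket (T x) (T y)"
  shows "(\<forall>x. T x = 0) \<or> (\<forall>x. T x = 0 \<longrightarrow> x = 0)"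
proof -
  have "T 0 = 0"
    using assms(1)[of 0 0] by simp
  then have "lie_ideal scale bracket {x. T x = 0}"
    by (auto simp: lie_ideal_def subspace_def assms bracket_zero_right)
  then show ?thesis
    using no_proper_ideals by blast
qed

lemma injective_self_adjoint_endomorphism_CHAR_2:
  assumes char: "CHAR('k) = 2"
    and add: "\<And>x y. T (x + y) = T x + T y"
    and hom: "\<And>x y. T (bracket x y) = bracket (T x) (T y)"
    and adj: "\<And>x y. bracket (T x) y = bracket x (T y)"
    and inj: "\<And>x. T x = 0 \<Longrightarrow> x = 0"
  shows "T x = x"
proof -
  have twice: "u + u = 0" for u :: 'v
    using char by (rule add_self_CHAR_2)
  have minus: "- u = u" for u :: 'v
    using twice by (rule minus_unique)
  have comm: "bracket u v = bracket v u" for u v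
    using bracket_antisym[of u v] by (simp add: minus)
  have T_bracket: "T (bracket u v) = bracket (T (T u)) v" "T (bracket u v) = bracket u (T (T v))"
    for u v
    by (simp_all only: hom adj)
  define R where "R u = T u + T (T u)" for u
  have R_add: "R (u + v) = R u + R v" for u v
    by (simp add: R_def add ac_simps)
  have TR: "T (R u) = R (T u)" for u
    by (simp add: R_def add)
  have R_adj: "bracket (R u) v = bracket u (R v)" for u v
    by (simp add: R_def bracket_add_left bracket_add_right adj)
  have R_bracket: "bracket (R u) v = bracket (T u) v + T (bracket u v)" for u v
    by (simp add: R_def bracket_add_left T_bracket)
  define f where "f u v w = bracket (R u) (bracket v w)" for u v w
  have f_comm: "f u v w = f u w v" for u v w
    unfolding f_def by (simp add: comm)
  \<comment> \<open>Both parts of \<open>R u\<close> are rewritten by the Jacobi identity until they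
    combine into the action of \<open>R\<close> on \<open>bracket u v\<close>.\<close>
  have f_rot: "f u v w = f w u v" for u v w
  proof -
    have "bracket (T u) (bracket v w) = bracket u (bracket (T (T v)) w)"
      by (simp only: adj[of u] T_bracket(1))
    also have "\<dots> = bracket (bracket u (T (T v))) w + bracket (T (T v)) (bracket u w)"
      by (rule jacobi_leibniz)
    also have "\<dots> = bracket (T (bracket u v)) w + T (bracket v (bracket u w))"
      by (simp only: T_bracket(1)[of v] T_bracket(2)[of u])
    finally have "f u v w = bracket (T (bracket u v)) w
        + (T (bracket v (bracket u w)) + T (bracket u (bracket v w)))"
      by (simp add: f_def R_bracket add.assoc)
    also have "T (bracket v (bracket u w)) + T (bracket u (bracket v w)) = T (bracket (bracket u v) w)"
    proof -
      \<comment> \<open>The Jacobi identity produces \<open>bracket v (bracket u w)\<close> a second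
        time, and the two copies cancel.\<close>
      have "bracket v (bracket u w) + bracket u (bracket v w)
          = bracket (bracket u v) w + (bracket v (bracket u w) + bracket v (bracket u w))"
        by (simp only: jacobi_leibniz[of u v w] ac_simps)
      then show ?thesis
        by (simp only: twice add[symmetric] add_0_right)
    qed
    also have "bracket (T (bracket u v)) w + T (bracket (bracket u v) w) = bracket (R (bracket u v)) w"
      by (simp add: R_bracket)
    also have "\<dots> = f w u v"
      by (simp add: f_def R_adj comm[of _ w])
    finally show ?thesis .
  qed
  have f_swap: "f u v w = f v u w" for u v w
    using f_rot[of u v w] f_comm[of w u v] f_rot[of v u w] by (simp only:)
  have f_T: "f (T u) v w = f u (T v) (T w)" for u v w
    by (simp only: f_def TR[symmetric] adj hom)
  \<comment> \<open>By symmetry of \<open>f\<close>, \<open>f (T u) (T v) (T w)\<close> can be read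
    through \<open>f_T\<close> from either of its first two arguments.\<close>
  have f_TT: "f (T (T u)) v w = f u (T (T v)) w" for u v w
  proof -
    have "f (T (T u)) v w = f (T u) (T v) (T w)"
      by (rule f_T)
    also have "\<dots> = f (T v) (T u) (T w)"
      by (rule f_swap)
    also have "\<dots> = f (T (T v)) u w"
      by (rule f_T[symmetric])
    also have "\<dots> = f u (T (T v)) w"
      by (rule f_swap)
    finally show ?thesis .
  qed
  have f_R: "f (R u) v w = f (T u) v w + f (T (T u)) v w" for u v w
    by (simp only: f_def R_def[of u] R_add bracket_add_left)
  \<comment> \<open>A single \<open>T\<close> moved onto \<open>bracket v w\<close> becomes
    \<open>T\<close> squared on \<open>v\<close>, which \<open>f_TT\<close> carries back to
    \<open>u\<close>.\<close>
  have "f (T (T u)) v w = f (T u) v w" for u v w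
  proof -
    have "f (T u) v w = bracket (R u) (T (bracket v w))"
      by (simp only: f_def TR[symmetric] adj)
    also have "\<dots> = f u (T (T v)) w"
      by (simp only: f_def T_bracket(1))
    finally show ?thesis
      by (simp only: f_TT)
  qed
  then have "f (R u) v w = f (T u) v w + f (T u) v w" for u v w
    by (simp only: f_R)
  then have "f (R u) v w = 0" for u v w
    by (simp only: twice)
  then have R_sq: "R (R u) = 0" for u
    unfolding f_def by (rule annihilator_derived_trivial)
  have "T (T (u + T (T u))) = 0" for u
  proof -
    \<comment> \<open>Expansion of the square of \<open>T + T^2\<close>; the doubled cubic term
      vanishes.\<close>
    have "R (R u) = T (T (u + T (T u))) + (T (T (T u)) + T (T (T u)))"
      by (simp add: R_def add ac_simps)
    then show ?thesis
      by (simp add: R_sq twice)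
  qed
  then have "u + T (T u) = 0" for u
    using inj by blast
  then have T_T: "T (T u) = u" for u
    using minus_unique[of u "T (T u)"] by (simp only: minus)
  show ?thesis
    \<comment> \<open>Since \<open>T\<close> squares to the identity, \<open>T_bracket\<close> shows
      that \<open>T\<close> fixes every bracket, and \<open>adj\<close> moves \<open>T\<close> from
      \<open>x\<close> onto one.\<close>
    by (rule eqI_bracket_bracket) (simp only: adj T_bracket(1) T_T)
qed

end

theorem proposition5p9:
  fixes scale :: "'k::field \<Rightarrow> 'v::ab_group_add \<Rightarrow> 'v"
    and bracket :: "'v \<Rightarrow> 'v \<Rightarrow> 'v"
    and p :: "'v \<Rightarrow> 'v \<Rightarrow> 'v"
  assumes "CHAR('k) = 2"
    and "simple_lie_algebra scale bracket"
    and "taut scale bracket"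
    and "cpa_structure scale bracket p"
  shows "(\<forall>x y. p x y = 0) \<or> (\<forall>x y. p x y = bracket x y)"
proof -
  interpret simple_lie_algebra scale bracket by fact
  have "range p \<subseteq> Inn bracket"
    using assms cpa_lie_hom_to_Der by (auto simp: taut_def)
  then have "\<forall>x. \<exists>t. p x = bracket t"
    by (auto simp: Inn_def image_subset_iff)
  then obtain T where T: "p x = bracket (T x)" for x
    by metis
  \<comment> \<open>\<open>T\<close> was chosen pointwise; its values are unique because the center
    is trivial, so it inherits the linearity of \<open>p\<close>.\<close>
  have add: "T (x + y) = T x + T y" for x y
    by (rule eqI_bracket) (simp add: T[symmetric] bracket_add_left cpa_add[OF assms(4)])
  have scl: "T (scale c x) = scale c (T x)" for c x
    by (rule eqI_bracket) (simp add: T[symmetric] bracket_scale_left cpa_scale[OF assms(4)])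
  have hom: "T (bracket x y) = bracket (T x) (T y)" for x y
  proof (rule eqI_bracket)
    fix z
    have "bracket (T (bracket x y)) z
        = bracket (T x) (bracket (T y) z) - bracket (T y) (bracket (T x) z)"
      using assms(4) unfolding cpa_structure_def T by blast
    then show "bracket (T (bracket x y)) z = bracket (bracket (T x) (T y)) z"
      by (simp add: jacobi_leibniz[of "T x"])
  qed
  have adj: "bracket (T x) y = bracket x (T y)" for x y
  proof -
    have "bracket (T x) y = bracket (T y) x"
      using assms(4) unfolding cpa_structure_def T by blast
    also have "\<dots> = - bracket x (T y)"
      by (rule bracket_antisym)
    also have "\<dots> = bracket x (T y)"
      using add_self_CHAR_2[OF assms(1)] by (rule minus_unique)
    finally show ?thesis .
  qed
  from endomorphism_zero_or_inj[OF add scl hom] show ?thesis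
  proof
    assume "\<forall>x. T x = 0"
    then show ?thesis
      by (simp add: T bracket_zero_left)
  next
    assume "\<forall>x. T x = 0 \<longrightarrow> x = 0"
    then have "T x = x" for x
      using injective_self_adjoint_endomorphism_CHAR_2[OF assms(1) add hom adj] by blast
    then show ?thesis
      by (simp add: T)
  qed
qed

end
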